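(* Let $\gamma>0$ and let $L:\mathbb Z^+\to\mathcal L(\mathcal B^\gamma,\mathcal X)$. Consider the nonhomogeneous system $x(n+1)=L(n)x_n+f(n)$, $n\ge 0$, and the associated homogeneous system $x(n+1)=L(n)x_n$, $n\ge 0$. Then the following statements are equivalent: (i) The homogeneous system is uniformly stable in $\mathcal B^\gamma$ (or, equivalently, uniformly stable in $\mathcal X$ with respect to $\mathcal B^\gamma$). (ii) The nonhomogeneous system is $(\ell^1,\ell^\infty)$-stable and there exists $m\in\mathbb Z^-$ such that $\sup_{n\in\mathbb Z^+}\|L(n)P_{[-\infty,m]}\|_{\mathcal B^\gamma\to\mathcal X}<\infty$.
   Context: $\mathbb Z^+$ and $\mathbb Z^-$ are the sets of nonnegative and nonpositive integers. $(\mathcal X,|\cdot|)$ is a (real or complex) Banach space. $\mathcal X^{\mathbb Z^-}$ is the vector space of all tuples $\varphi=(\varphi^{[m]})_{m\le 0}$ with $\varphi^{[m]}\in\mathcal X$; its zero vector is $0_{\mathcal B}$. For $\gamma\in\mathbb R$, $\mathcal B^\gamma=\{\varphi\in\mathcal X^{\mathbb Z^-}: |\varphi|_{\mathcal B^\gamma}:=\sup_{m\le 0}|\varphi^{[m]}|e^{\gamma m}<\infty\}$ (the phase space). $\mathcal L(\mathcal B^\gamma,\mathcal X)$ is the space of bounded linear operators with operator norm $\|\cdot\|_{\mathcal B^\gamma\to\mathcal X}$. For $1\le p\le\infty$, $\ell^p(\mathcal X)$ is the usual space of $p$-summable (bounded if $p=\infty$) functions $\mathbb Z^+\to\mathcal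 X$. For $x:\mathbb Z\to\mathcal X$ and $n\in\mathbb Z$, the prehistory $x_n\in\mathcal X^{\mathbb Z^-}$ is defined by $x_n^{[m]}=x(n+m)$, $m\le 0$. For $\tau\in\mathbb Z^+$, $\varphi\in\mathcal B^\gamma$ and $f:\mathbb Z^+\to\mathcal X$, $x(\cdot,\tau,\varphi;f):\mathbb Z\to\mathcal X$ is the unique function $x$ with $x_\tau=\varphi$ and $x(n+1)=L(n)x_n+f(n)$ for all $n\ge\tau$; $x_n(\tau,\varphi;f)$ is its prehistory at $n$. $\mathbf 0$ denotes the zero function $f$. $P_{[-\infty,m]}:\mathcal X^{\mathbb Z^-}\to\mathcal X^{\mathbb Z^-}$ keeps the coordinates with index $\le m$ and replaces all other coordinates by zero. The nonhomogeneous system is $(\ell^1,\ell^\infty)$-stable if $x(\cdot,0,0_{\mathcal B};f)$ (restricted to $\mathbb Z^+$) belongs to $\ell^\infty(\mathcal X)$ for every $f\in\ell^1(\mathcal X)$. The homogeneous system is uniformly stable in $\mathcal X$ with respect to $\mathcal B^\gamma$ if there exists $K\ge1$ such that $|x(n,\tau,\varphi;\mathbf 0)|\le K|\varphi|_{\mathcal B^\gamma}$ for all $n\ge\tau\ge0$ and all $\varphi\in\mathcal B^\gamma$. It is uniformly stable in $\mathcal B^\gamma$ if the same holds with $|x(n,\tau,\varphi;\mathbf 0)|$ replaced by $|x_n(\tau,\varphi;\mathbf 0)|_{\mathcal B^\gamma}$. *)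

theory Defs
  imports "HOL-Analysis.Analysis"
begin

text \<open>
  The scalar field is taken to be the reals. A complex Banach space is a real one with the same
  norm, and its bounded complex-linear operators are in particular bounded real-linear with the
  same operator norm, so the complex case is an instance.

  A tuple \<open>\<phi>\<close> indexed by the nonpositive integers is encoded as a function on \<open>nat\<close>: the value
  \<open>\<phi> k\<close> is the coordinate of index \<open>m = - k\<close>.
\<close>

type_synonym 'a history = "nat \<Rightarrow> 'a"

definition phase_norm :: "real \<Rightarrow> ('a::real_normed_vector) history \<Rightarrow> real" where
  "phase_norm \<gamma> \<phi> = (SUP k. norm (\<phi> k) * exp (\<gamma> * (- real k)))"

definition phase_space :: "real \<Rightarrow> ('a::real_normed_vector) history set" where
  "phase_space \<gamma> = {\<phi>. bdd_above (range (\<lambda>k. norm (\<phi> k) * exp (\<gamma> * (- real k))))}"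

text \<open>
  Since the phase space depends on the real parameter \<open>\<gamma>\<close>, it is a carrier set and not a type;
  operators on it are functions on all histories whose values off the carrier are irrelevant.
\<close>

definition bounded_operators :: "real \<Rightarrow> (('a::real_normed_vector) history \<Rightarrow> 'a) set" where
  "bounded_operators \<gamma> = {T.
     (\<forall>\<phi>\<in>phase_space \<gamma>. \<forall>\<psi>\<in>phase_space \<gamma>. T (\<lambda>k. \<phi> k + \<psi> k) = T \<phi> + T \<psi>) \<and>
     (\<forall>c. \<forall>\<phi>\<in>phase_space \<gamma>. T (\<lambda>k. c *\<^sub>R \<phi> k) = c *\<^sub>R T \<phi>) \<and>
     (\<exists>C. \<forall>\<phi>\<in>phase_space \<gamma>. norm (T \<phi>) \<le> C * phase_norm \<gamma> \<phi>)}"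

definition operator_norm :: "real \<Rightarrow> (('a::real_normed_vector) history \<Rightarrow> 'a) \<Rightarrow> real" where
  "operator_norm \<gamma> T = (SUP \<phi>\<in>{\<phi>\<in>phase_space \<gamma>. phase_norm \<gamma> \<phi> \<le> 1}. norm (T \<phi>))"

definition tail_proj :: "int \<Rightarrow> ('a::zero) history \<Rightarrow> 'a history" where
  "tail_proj m \<phi> = (\<lambda>k. if - int k \<le> m then \<phi> k else 0)"

definition prehistory :: "(int \<Rightarrow> 'a) \<Rightarrow> int \<Rightarrow> 'a history" where
  "prehistory x n = (\<lambda>k. x (n - int k))"

definition is_solution ::
  "(nat \<Rightarrow> ('a::plus) history \<Rightarrow> 'a) \<Rightarrow> nat \<Rightarrow> 'a history \<Rightarrow> (nat \<Rightarrow> 'a) \<Rightarrow> (int \<Rightarrow> 'a) \<Rightarrow> bool" where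
  "is_solution L \<tau> \<phi> f x \<longleftrightarrow>
     prehistory x (int \<tau>) = \<phi> \<and>
     (\<forall>n\<ge>\<tau>. x (int n + 1) = L n (prehistory x (int n)) + f n)"

lemma ex1_solution: "\<exists>!x. is_solution L \<tau> \<phi> f x"
proof (rule ex_ex1I)
  define h where "h = rec_nat \<phi>
    (\<lambda>j g k. case k of 0 \<Rightarrow> L (\<tau> + j) g + f (\<tau> + j) | Suc i \<Rightarrow> g i)"
  define x where "x i = (if i \<le> int \<tau> then \<phi> (nat (int \<tau> - i)) else h (nat (i - int \<tau>)) 0)" for i
  have h0: "h 0 = \<phi>" by (simp add: h_def)
  have hS: "h (Suc j) = (\<lambda>k. case k of 0 \<Rightarrow> L (\<tau> + j) (h j) + f (\<tau> + j) | Suc i \<Rightarrow> h j i)" for j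
    unfolding h_def by simp
  have pre: "prehistory x (int (\<tau> + j)) = h j" for j
  proof (induction j)
    case 0
    show ?case by (auto simp: prehistory_def x_def h0)
  next
    case (Suc j)
    show ?case
    proof
      fix k
      show "prehistory x (int (\<tau> + Suc j)) k = h (Suc j) k"
      proof (cases k)
        case 0
        have "nat (int (\<tau> + Suc j) - int \<tau>) = Suc j" by simp
        then show ?thesis using 0 by (simp add: prehistory_def x_def)
      next
        case (Suc i)
        have "int (\<tau> + Suc j) - int (Suc i) = int (\<tau> + j) - int i" by simp
        then have "prehistory x (int (\<tau> + Suc j)) k = prehistory x (int (\<tau> + j)) i"
          unfolding prehistory_def Suc by (rule arg_cong)
        also have "\<dots> = h (Suc j) k" by (simp only: Suc.IH) (simp add: hS Suc)
        finally show ?thesis .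
      qed
    qed
  qed
  have "x (int n + 1) = L n (prehistory x (int n)) + f n" if le: "\<tau> \<le> n" for n
  proof -
    obtain j where n: "n = \<tau> + j" using le_Suc_ex[OF le] by blast
    have "x (int n + 1) = prehistory x (int (\<tau> + Suc j)) 0"
      by (simp add: prehistory_def n add_ac)
    also have "\<dots> = L n (prehistory x (int n)) + f n"
      by (simp only: pre n) (simp add: hS)
    finally show ?thesis .
  qed
  moreover have "prehistory x (int \<tau>) = \<phi>" using pre[of 0] h0 by simp
  ultimately show "\<exists>x. is_solution L \<tau> \<phi> f x" unfolding is_solution_def by blast
next
  fix x y
  assume x: "is_solution L \<tau> \<phi> f x" and y: "is_solution L \<tau> \<phi> f y"
  have pre: "prehistory x (int (\<tau> + j)) = prehistory y (int (\<tau> + j))" for j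
  proof (induction j)
    case 0
    show ?case using x y by (simp add: is_solution_def)
  next
    case (Suc j)
    have S: "int (\<tau> + Suc j) = int (\<tau> + j) + 1" by simp
    show ?case
    proof
      fix k
      show "prehistory x (int (\<tau> + Suc j)) k = prehistory y (int (\<tau> + Suc j)) k"
      proof (cases k)
        case 0
        have "x (int (\<tau> + j) + 1) = L (\<tau> + j) (prehistory x (int (\<tau> + j))) + f (\<tau> + j)"
          using x unfolding is_solution_def by (meson le_add1)
        moreover have "y (int (\<tau> + j) + 1) = L (\<tau> + j) (prehistory y (int (\<tau> + j))) + f (\<tau> + j)"
          using y unfolding is_solution_def by (meson le_add1)
        ultimately have "x (int (\<tau> + j) + 1) = y (int (\<tau> + j) + 1)"
          unfolding Suc.IH by (rule trans[OF _ sym])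
        then show ?thesis unfolding S prehistory_def 0 of_nat_0 diff_zero .
      next
        case (Suc i)
        have "int (\<tau> + Suc j) - int (Suc i) = int (\<tau> + j) - int i" by simp
        then show ?thesis using fun_cong[OF Suc.IH, of i]
          unfolding prehistory_def Suc by simp
      qed
    qed
  qed
  show "x = y"
  proof
    fix i
    define j where "j = nat (i - int \<tau>)"
    have "i = int (\<tau> + j) - int (nat (int (\<tau> + j) - i))" by (simp add: j_def)
    then show "x i = y i" using fun_cong[OF pre[of j], of "nat (int (\<tau> + j) - i)"]
      unfolding prehistory_def by simp
  qed
qed

definition solution ::
  "(nat \<Rightarrow> ('a::plus) history \<Rightarrow> 'a) \<Rightarrow> nat \<Rightarrow> 'a history \<Rightarrow> (nat \<Rightarrow> 'a) \<Rightarrow> int \<Rightarrow> 'a" where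
  "solution L \<tau> \<phi> f = (THE x. is_solution L \<tau> \<phi> f x)"

definition ell_1 :: "(nat \<Rightarrow> 'a::real_normed_vector) set" where
  "ell_1 = {f. summable (\<lambda>n. norm (f n))}"

definition ell_infinity :: "(nat \<Rightarrow> 'a::real_normed_vector) set" where
  "ell_infinity = {f. bounded (range f)}"

definition ell_1_infinity_stable ::
  "(nat \<Rightarrow> ('a::real_normed_vector) history \<Rightarrow> 'a) \<Rightarrow> bool" where
  "ell_1_infinity_stable L \<longleftrightarrow>
     (\<forall>f\<in>ell_1. (\<lambda>n::nat. solution L 0 (\<lambda>_. 0) f (int n)) \<in> ell_infinity)"

definition uniformly_stable_X ::
  "real \<Rightarrow> (nat \<Rightarrow> ('a::real_normed_vector) history \<Rightarrow> 'a) \<Rightarrow> bool" where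
  "uniformly_stable_X \<gamma> L \<longleftrightarrow>
     (\<exists>K\<ge>1. \<forall>\<tau> n. n \<ge> \<tau> \<longrightarrow> (\<forall>\<phi>\<in>phase_space \<gamma>.
        norm (solution L \<tau> \<phi> (\<lambda>_. 0) (int n)) \<le> K * phase_norm \<gamma> \<phi>))"

definition uniformly_stable_B ::
  "real \<Rightarrow> (nat \<Rightarrow> ('a::real_normed_vector) history \<Rightarrow> 'a) \<Rightarrow> bool" where
  "uniformly_stable_B \<gamma> L \<longleftrightarrow>
     (\<exists>K\<ge>1. \<forall>\<tau> n. n \<ge> \<tau> \<longrightarrow> (\<forall>\<phi>\<in>phase_space \<gamma>.
        phase_norm \<gamma> (prehistory (solution L \<tau> \<phi> (\<lambda>_. 0)) (int n)) \<le> K * phase_norm \<gamma> \<phi>))"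

end

theory Submission
  imports Defs
begin

text \<open>
  By variation of constants, the solution with zero initial history is the sum of the responses to
  the impulses \<open>f j\<close>. So uniform stability, applied to these impulses, bounds it by the
  \<open>\<ell>\<^sup>1\<close> norm of the forcing. Conversely, \<open>(\<ell>\<^sup>1, \<ell>\<^sup>\<infinity>)\<close>-stability and a gliding hump argument bound
  all impulse responses uniformly. This controls \<open>L n\<close> on histories supported in any fixed
  number of recent coordinates, and together with the tail hypothesis it bounds all \<open>L n\<close>
  uniformly. A homogeneous solution, set to zero up to its initial time, then solves the
  nonhomogeneous system with a forcing that decays geometrically, since \<open>\<gamma> > 0\<close> makes the phase
  norm of the shifted initial history decay; hence it is bounded.
\<close>

section \<open>Solutions and their prehistories\<close>

lemma solution_is_solution: "is_solution L \<tau> \<phi> f (solution L \<tau> \<phi> f)"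
  unfolding solution_def using ex1_solution by (rule theI')

lemma solution_eqI: "is_solution L \<tau> \<phi> f x \<Longrightarrow> solution L \<tau> \<phi> f = x"
  using ex1_solution solution_is_solution by blast

lemma solution_step:
  "\<tau> \<le> n \<Longrightarrow> solution L \<tau> \<phi> f (int n + 1) = L n (prehistory (solution L \<tau> \<phi> f) (int n)) + f n"
  using solution_is_solution[of L \<tau> \<phi> f] unfolding is_solution_def by blast

lemma solution_prehistory: "prehistory (solution L \<tau> \<phi> f) (int \<tau>) = \<phi>"
  using solution_is_solution[of L \<tau> \<phi> f] unfolding is_solution_def by blast

lemma solution_initial: "i \<le> int \<tau> \<Longrightarrow> solution L \<tau> \<phi> f i = \<phi> (nat (int \<tau> - i))"
  using fun_cong[OF solution_prehistory[of L \<tau> \<phi> f], of "nat (int \<tau> - i)"]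
  by (simp add: prehistory_def)

lemma prehistory_Suc: "prehistory x (int (Suc n)) = case_nat (x (int n + 1)) (prehistory x (int n))"
  by (auto simp: prehistory_def fun_eq_iff split: nat.splits intro!: arg_cong[of _ _ x])

section \<open>The phase space and its norm\<close>

lemma phase_bound:
  "\<phi> \<in> phase_space \<gamma> \<Longrightarrow> norm (\<phi> k) * exp (\<gamma> * (- real k)) \<le> phase_norm \<gamma> \<phi>"
  unfolding phase_norm_def phase_space_def by (rule cSUP_upper) auto

lemma phase_bound_0: "\<phi> \<in> phase_space \<gamma> \<Longrightarrow> norm (\<phi> 0) \<le> phase_norm \<gamma> \<phi>"
  using phase_bound[of \<phi> \<gamma> 0] by simp

lemma phase_norm_nonneg: "\<phi> \<in> phase_space \<gamma> \<Longrightarrow> 0 \<le> phase_norm \<gamma> \<phi>"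
  using phase_bound_0 norm_ge_zero by (rule order_trans[rotated])

lemma phase_spaceI:
  "(\<And>k. norm (\<phi> k) * exp (\<gamma> * (- real k)) \<le> C) \<Longrightarrow> \<phi> \<in> phase_space \<gamma>"
  unfolding phase_space_def by (auto simp: bdd_above_def)

lemma phase_norm_le:
  "(\<And>k. norm (\<phi> k) * exp (\<gamma> * (- real k)) \<le> C) \<Longrightarrow> phase_norm \<gamma> \<phi> \<le> C"
  unfolding phase_norm_def by (rule cSUP_least) auto

lemma phase_mono_bound:
  assumes "\<psi> \<in> phase_space \<gamma>" "\<And>k. norm (\<phi> k) \<le> norm (\<psi> k)"
  shows "norm (\<phi> k) * exp (\<gamma> * (- real k)) \<le> phase_norm \<gamma> \<psi>"
proof -
  have "norm (\<phi> k) * exp (\<gamma> * (- real k)) \<le> norm (\<psi> k) * exp (\<gamma> * (- real k))"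
    by (intro mult_right_mono assms) auto
  also have "\<dots> \<le> phase_norm \<gamma> \<psi>" by (rule phase_bound[OF assms(1)])
  finally show ?thesis .
qed

lemma phase_space_mono:
  assumes "\<psi> \<in> phase_space \<gamma>" "\<And>k. norm (\<phi> k) \<le> norm (\<psi> k)"
  shows "\<phi> \<in> phase_space \<gamma>"
  by (rule phase_spaceI) (rule phase_mono_bound[OF assms])

lemma phase_norm_mono:
  assumes "\<psi> \<in> phase_space \<gamma>" "\<And>k. norm (\<phi> k) \<le> norm (\<psi> k)"
  shows "phase_norm \<gamma> \<phi> \<le> phase_norm \<gamma> \<psi>"
  by (rule phase_norm_le) (rule phase_mono_bound[OF assms])

lemma phase_space_zero: "(\<lambda>_. 0) \<in> phase_space \<gamma>"
  by (rule phase_spaceI[of _ _ 0]) simp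

lemma phase_space_add:
  assumes "\<phi> \<in> phase_space \<gamma>" "\<psi> \<in> phase_space \<gamma>"
  shows "(\<lambda>k. \<phi> k + \<psi> k) \<in> phase_space \<gamma>"
proof (rule phase_spaceI)
  fix k
  have "norm (\<phi> k + \<psi> k) * exp (\<gamma> * (- real k)) \<le> (norm (\<phi> k) + norm (\<psi> k)) * exp (\<gamma> * (- real k))"
    by (intro mult_right_mono norm_triangle_ineq) auto
  also have "\<dots> \<le> phase_norm \<gamma> \<phi> + phase_norm \<gamma> \<psi>"
    unfolding distrib_right by (intro add_mono phase_bound assms)
  finally show "norm (\<phi> k + \<psi> k) * exp (\<gamma> * (- real k)) \<le> phase_norm \<gamma> \<phi> + phase_norm \<gamma> \<psi>" .
qed

lemma phase_scale_eq:
  "norm (c *\<^sub>R \<phi> k) * exp (\<gamma> * (- real k)) = \<bar>c\<bar> * (norm (\<phi> k) * exp (\<gamma> * (- real k)))"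
  by simp

lemma phase_space_scale: "\<phi> \<in> phase_space \<gamma> \<Longrightarrow> (\<lambda>k. c *\<^sub>R \<phi> k) \<in> phase_space \<gamma>"
  by (rule phase_spaceI, subst phase_scale_eq, rule mult_left_mono[OF phase_bound]) auto

lemma phase_norm_scale_le:
  "\<phi> \<in> phase_space \<gamma> \<Longrightarrow> phase_norm \<gamma> (\<lambda>k. c *\<^sub>R \<phi> k) \<le> \<bar>c\<bar> * phase_norm \<gamma> \<phi>"
  by (rule phase_norm_le, subst phase_scale_eq, rule mult_left_mono[OF phase_bound]) auto

lemma phase_space_sum:
  "(\<And>i. i \<in> I \<Longrightarrow> \<phi> i \<in> phase_space \<gamma>) \<Longrightarrow> (\<lambda>k. \<Sum>i\<in>I. \<phi> i k) \<in> phase_space \<gamma>"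
  by (induction I rule: infinite_finite_induct) (simp_all add: phase_space_zero phase_space_add)

section \<open>Single coordinates and tails of histories\<close>

text \<open>\<open>single 0 v\<close> is the history left by an impulse that has just produced the
  value \<open>v\<close> after a zero past.\<close>

definition single :: "nat \<Rightarrow> 'a::zero \<Rightarrow> 'a history" where
  "single k v = (\<lambda>i. if i = k then v else 0)"

lemma single_add: "single k (u + v) = (\<lambda>i. single k u i + single k (v::'a::real_normed_vector) i)"
  by (auto simp: single_def)

lemma single_scale: "single k (c *\<^sub>R v) = (\<lambda>i. c *\<^sub>R single k (v::'a::real_normed_vector) i)"
  by (auto simp: single_def)

lemma single_phase_space:
  fixes v :: "'a::real_normed_vector"
  shows "single k v \<in> phase_space \<gamma>"
  by (rule phase_spaceI[of _ _ "norm v * exp (\<gamma> * (- real k))"]) (auto simp: single_def)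

lemma phase_norm_single_le:
  fixes v :: "'a::real_normed_vector"
  shows "phase_norm \<gamma> (single 0 v) \<le> norm v"
  by (rule phase_norm_le) (auto simp: single_def)

text \<open>In the encoding by natural numbers, index at most \<open>- int M\<close> means
  \<open>k \<ge> M\<close>, so the sum supplies exactly the coordinates that the projection
  removes.\<close>

lemma tail_proj_decomp:
  fixes \<phi> :: "'a::real_normed_vector history"
  shows "\<phi> = (\<lambda>k. (\<Sum>i<M. single i (\<phi> i) k) + tail_proj (- int M) \<phi> k)"
proof
  fix k
  have "(\<Sum>i<M. single i (\<phi> i) k) = (if k < M then \<phi> k else 0)"
    unfolding single_def by simp
  then show "\<phi> k = (\<Sum>i<M. single i (\<phi> i) k) + tail_proj (- int M) \<phi> k"
    by (auto simp: tail_proj_def)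
qed

lemma tail_proj_phase_space: "\<phi> \<in> phase_space \<gamma> \<Longrightarrow> tail_proj m \<phi> \<in> phase_space \<gamma>"
  by (erule phase_space_mono) (auto simp: tail_proj_def)

lemma phase_norm_tail_proj: "\<phi> \<in> phase_space \<gamma> \<Longrightarrow> phase_norm \<gamma> (tail_proj m \<phi>) \<le> phase_norm \<gamma> \<phi>"
  by (erule phase_norm_mono) (auto simp: tail_proj_def)

section \<open>Bounded operators on the phase space\<close>

context
  fixes T :: "('a::real_normed_vector) history \<Rightarrow> 'a" and \<gamma>
  assumes T: "T \<in> bounded_operators \<gamma>"
begin

lemma operator_add:
  "\<phi> \<in> phase_space \<gamma> \<Longrightarrow> \<psi> \<in> phase_space \<gamma> \<Longrightarrow> T (\<lambda>k. \<phi> k + \<psi> k) = T \<phi> + T \<psi>"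
  using T unfolding bounded_operators_def by blast

lemma operator_scale: "\<phi> \<in> phase_space \<gamma> \<Longrightarrow> T (\<lambda>k. c *\<^sub>R \<phi> k) = c *\<^sub>R T \<phi>"
  using T unfolding bounded_operators_def by blast

lemma operator_zero: "T (\<lambda>_. 0) = 0"
  using operator_scale[OF phase_space_zero, of 0] by simp

lemma operator_sum:
  "(\<And>i. i \<in> I \<Longrightarrow> \<phi> i \<in> phase_space \<gamma>) \<Longrightarrow> T (\<lambda>k. \<Sum>i\<in>I. \<phi> i k) = (\<Sum>i\<in>I. T (\<phi> i))"
  by (induction I rule: infinite_finite_induct)
    (simp_all add: operator_zero operator_add phase_space_sum)

lemma operator_bound:
  obtains C where "C \<ge> 0" "\<And>\<phi>. \<phi> \<in> phase_space \<gamma> \<Longrightarrow> norm (T \<phi>) \<le> C * phase_norm \<gamma> \<phi>"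
proof -
  obtain C where C: "\<And>\<phi>. \<phi> \<in> phase_space \<gamma> \<Longrightarrow> norm (T \<phi>) \<le> C * phase_norm \<gamma> \<phi>"
    using T unfolding bounded_operators_def by blast
  have "norm (T \<phi>) \<le> max 0 C * phase_norm \<gamma> \<phi>" if "\<phi> \<in> phase_space \<gamma>" for \<phi>
    using C[OF that] mult_right_mono[OF max.cobounded2 phase_norm_nonneg[OF that], of C 0] by linarith
  then show thesis using that[of "max 0 C"] by simp
qed

text \<open>The supremum controls \<open>T\<close> on the unit ball, and homogeneity carries this
  over to all histories.\<close>

lemma operator_norm_bound:
  assumes "operator_norm \<gamma> (T \<circ> tail_proj m) \<le> B" and \<phi>: "\<phi> \<in> phase_space \<gamma>"
  shows "norm (T (tail_proj m \<phi>)) \<le> B * phase_norm \<gamma> \<phi>"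
proof -
  obtain C where C: "C \<ge> 0" "\<And>\<phi>. \<phi> \<in> phase_space \<gamma> \<Longrightarrow> norm (T \<phi>) \<le> C * phase_norm \<gamma> \<phi>"
    using operator_bound by blast
  \<comment> \<open>A real \<open>SUP\<close> says nothing unless the set is bounded above; this
    bound provides that, and it also settles histories of norm zero, which cannot be
    normalized.\<close>
  have bd: "norm (T (tail_proj m \<psi>)) \<le> C * phase_norm \<gamma> \<psi>" if "\<psi> \<in> phase_space \<gamma>" for \<psi>
    using C(2)[OF tail_proj_phase_space[OF that]] mult_left_mono[OF phase_norm_tail_proj[OF that] C(1)]
    by (rule order_trans)
  have unit: "norm (T (tail_proj m \<psi>)) \<le> B" if "\<psi> \<in> phase_space \<gamma>" "phase_norm \<gamma> \<psi> \<le> 1" for \<psi>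
  proof -
    have "norm ((T \<circ> tail_proj m) \<psi>) \<le> operator_norm \<gamma> (T \<circ> tail_proj m)"
      unfolding operator_norm_def
    proof (rule cSUP_upper)
      show "bdd_above ((\<lambda>\<phi>. norm ((T \<circ> tail_proj m) \<phi>)) ` {\<phi> \<in> phase_space \<gamma>. phase_norm \<gamma> \<phi> \<le> 1})"
        using order_trans[OF bd mult_left_le[OF _ C(1)]] by (auto intro!: bdd_aboveI[of _ C])
    qed (use that in auto)
    then show ?thesis using assms(1) by simp
  qed
  show ?thesis
  proof (cases "phase_norm \<gamma> \<phi> = 0")
    case True
    then show ?thesis using bd[OF \<phi>] by simp
  next
    case False
    define r where "r = phase_norm \<gamma> \<phi>"
    have r: "r > 0" using False phase_norm_nonneg[OF \<phi>] by (simp add: r_def)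
    define \<psi> where "\<psi> = (\<lambda>k. (1 / r) *\<^sub>R \<phi> k)"
    have \<psi>: "\<psi> \<in> phase_space \<gamma>" unfolding \<psi>_def by (rule phase_space_scale[OF \<phi>])
    have "phase_norm \<gamma> \<psi> \<le> 1"
      using phase_norm_scale_le[OF \<phi>, of "1 / r"] r by (simp add: \<psi>_def r_def)
    then have "norm (T (tail_proj m \<psi>)) \<le> B" using unit \<psi> by blast
    moreover have "tail_proj m \<psi> = (\<lambda>k. (1 / r) *\<^sub>R tail_proj m \<phi> k)"
      by (auto simp: tail_proj_def \<psi>_def)
    then have "T (tail_proj m \<psi>) = (1 / r) *\<^sub>R T (tail_proj m \<phi>)"
      using operator_scale[OF tail_proj_phase_space[OF \<phi>]] by simp
    ultimately show ?thesis using r by (simp add: r_def field_simps)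
  qed
qed

end

section \<open>Growth and linearity of homogeneous solutions\<close>

text \<open>Moving a history one step into the past lowers the weight of each coordinate, because
  \<open>\<gamma> > 0\<close>; only the new coordinate \<open>a\<close> can add to the norm.\<close>

lemma phase_case_nat_bound:
  assumes "\<gamma> > 0" "\<phi> \<in> phase_space \<gamma>"
  shows "norm (case_nat a \<phi> k) * exp (\<gamma> * (- real k)) \<le> norm a + phase_norm \<gamma> \<phi>"
proof (cases k)
  case 0
  then show ?thesis using phase_norm_nonneg[OF assms(2)] by simp
next
  case (Suc j)
  have "norm (\<phi> j) * exp (\<gamma> * (- real (Suc j))) \<le> norm (\<phi> j) * exp (\<gamma> * (- real j))"
    using assms(1) by (intro mult_left_mono) (auto simp: algebra_simps)
  also have "\<dots> \<le> phase_norm \<gamma> \<phi>" by (rule phase_bound[OF assms(2)])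
  finally show ?thesis using Suc by (simp add: add_increasing)
qed

text \<open>Each step of the equation costs a factor \<open>D + 1\<close>, where \<open>D\<close>
  bounds \<open>L n\<close>. The resulting \<open>C\<close> depends on \<open>\<tau>\<close> and
  \<open>n\<close>; this suffices to keep prehistories in the phase space and to make impulse
  responses continuous in the impulse.\<close>

lemma homogeneous_bound:
  assumes "\<gamma> > 0" and L: "\<And>n. L n \<in> bounded_operators \<gamma>" and "\<tau> \<le> n"
  shows "\<exists>C. \<forall>\<phi>\<in>phase_space \<gamma>. prehistory (solution L \<tau> \<phi> (\<lambda>_. 0)) (int n) \<in> phase_space \<gamma> \<and>
           phase_norm \<gamma> (prehistory (solution L \<tau> \<phi> (\<lambda>_. 0)) (int n)) \<le> C * phase_norm \<gamma> \<phi>"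
  using \<open>\<tau> \<le> n\<close>
proof (induction n rule: dec_induct)
  case base
  show ?case by (rule exI[of _ 1]) (simp add: solution_prehistory)
next
  case (step n)
  let ?x = "\<lambda>\<phi>. solution L \<tau> \<phi> (\<lambda>_. 0)"
  obtain C where C: "\<And>\<phi>. \<phi> \<in> phase_space \<gamma> \<Longrightarrow> prehistory (?x \<phi>) (int n) \<in> phase_space \<gamma>"
    "\<And>\<phi>. \<phi> \<in> phase_space \<gamma> \<Longrightarrow> phase_norm \<gamma> (prehistory (?x \<phi>) (int n)) \<le> C * phase_norm \<gamma> \<phi>"
    using step.IH by blast
  obtain D where D: "D \<ge> 0" "\<And>\<phi>. \<phi> \<in> phase_space \<gamma> \<Longrightarrow> norm (L n \<phi>) \<le> D * phase_norm \<gamma> \<phi>"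
    using operator_bound[OF L] by blast
  have "norm (prehistory (?x \<phi>) (int (Suc n)) k) * exp (\<gamma> * (- real k)) \<le> ((D + 1) * C) * phase_norm \<gamma> \<phi>"
    if \<phi>: "\<phi> \<in> phase_space \<gamma>" for \<phi> k
  proof -
    have "norm (prehistory (?x \<phi>) (int (Suc n)) k) * exp (\<gamma> * (- real k))
        \<le> norm (?x \<phi> (int n + 1)) + phase_norm \<gamma> (prehistory (?x \<phi>) (int n))"
      unfolding prehistory_Suc by (rule phase_case_nat_bound[OF assms(1) C(1)[OF \<phi>]])
    also have "\<dots> \<le> (D + 1) * phase_norm \<gamma> (prehistory (?x \<phi>) (int n))"
      using D(2)[OF C(1)[OF \<phi>]] solution_step[OF step.hyps(1), of L \<phi> "\<lambda>_. 0"]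
      by (simp add: algebra_simps)
    also have "\<dots> \<le> (D + 1) * (C * phase_norm \<gamma> \<phi>)"
      using D(1) C(2)[OF \<phi>] by (intro mult_left_mono) auto
    finally show ?thesis by (simp add: mult.assoc)
  qed
  then show ?case
    by (intro exI[of _ "(D + 1) * C"] ballI conjI) (rule phase_spaceI phase_norm_le, blast)+
qed

lemma homogeneous_phase_space:
  assumes "\<gamma> > 0" "\<And>n. L n \<in> bounded_operators \<gamma>" "\<tau> \<le> n" "\<phi> \<in> phase_space \<gamma>"
  shows "prehistory (solution L \<tau> \<phi> (\<lambda>_. 0)) (int n) \<in> phase_space \<gamma>"
  using homogeneous_bound[of \<gamma> L \<tau> n] assms by blast

text \<open>By uniqueness it is enough that the sum solves the equation. \<open>L n\<close> is
  additive on the phase space only, hence the appeal to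
  \<open>homogeneous_phase_space\<close>.\<close>

lemma homogeneous_add:
  assumes "\<gamma> > 0" and L: "\<And>n. L n \<in> bounded_operators \<gamma>"
    and "\<phi> \<in> phase_space \<gamma>" "\<psi> \<in> phase_space \<gamma>"
  shows "solution L \<tau> (\<lambda>k. \<phi> k + \<psi> k) (\<lambda>_. 0) =
    (\<lambda>i. solution L \<tau> \<phi> (\<lambda>_. 0) i + solution L \<tau> \<psi> (\<lambda>_. 0) i)" (is "_ = (\<lambda>i. ?x i + ?y i)")
proof (rule solution_eqI, unfold is_solution_def, safe)
  have split: "prehistory (\<lambda>i. ?x i + ?y i) i = (\<lambda>k. prehistory ?x i k + prehistory ?y i k)" for i
    by (simp add: prehistory_def)
  show "prehistory (\<lambda>i. ?x i + ?y i) (int \<tau>) = (\<lambda>k. \<phi> k + \<psi> k)"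
    by (simp add: split solution_prehistory)
  fix n assume "\<tau> \<le> n"
  then show "?x (int n + 1) + ?y (int n + 1) = L n (prehistory (\<lambda>i. ?x i + ?y i) (int n)) + 0"
    unfolding split
    by (simp add: solution_step operator_add[OF L] homogeneous_phase_space assms)
qed

lemma homogeneous_scale:
  assumes "\<gamma> > 0" and L: "\<And>n. L n \<in> bounded_operators \<gamma>" and "\<phi> \<in> phase_space \<gamma>"
  shows "solution L \<tau> (\<lambda>k. c *\<^sub>R \<phi> k) (\<lambda>_. 0) = (\<lambda>i. c *\<^sub>R solution L \<tau> \<phi> (\<lambda>_. 0) i)"
    (is "_ = (\<lambda>i. c *\<^sub>R ?x i)")
proof (rule solution_eqI, unfold is_solution_def, safe)
  have split: "prehistory (\<lambda>i. c *\<^sub>R ?x i) i = (\<lambda>k. c *\<^sub>R prehistory ?x i k)" for i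
    by (simp add: prehistory_def)
  show "prehistory (\<lambda>i. c *\<^sub>R ?x i) (int \<tau>) = (\<lambda>k. c *\<^sub>R \<phi> k)"
    by (simp add: split solution_prehistory)
  fix n assume "\<tau> \<le> n"
  then show "c *\<^sub>R ?x (int n + 1) = L n (prehistory (\<lambda>i. c *\<^sub>R ?x i) (int n)) + 0"
    unfolding split
    by (simp add: solution_step operator_scale[OF L] homogeneous_phase_space assms)
qed

section \<open>Impulse responses and variation of constants\<close>

text \<open>This is the fundamental solution: a forcing equal to \<open>v\<close> at time
  \<open>j\<close> and zero elsewhere first shows at time \<open>Suc j\<close>, from where the
  motion is homogeneous with history \<open>single 0 v\<close>.\<close>

definition impulse_response :: "(nat \<Rightarrow> 'a::real_normed_vector history \<Rightarrow> 'a) \<Rightarrow> nat \<Rightarrow> 'a \<Rightarrow> int \<Rightarrow> 'a" where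
  "impulse_response L j v = solution L (Suc j) (single 0 v) (\<lambda>_. 0)"

lemma impulse_response_early: "i \<le> int j \<Longrightarrow> impulse_response L j v i = 0"
  unfolding impulse_response_def by (subst solution_initial) (auto simp: single_def)

lemma impulse_response_Suc: "impulse_response L j v (int j + 1) = v"
  unfolding impulse_response_def by (subst solution_initial) (auto simp: single_def)

lemma impulse_response_step:
  "j < n \<Longrightarrow> impulse_response L j v (int n + 1) = L n (prehistory (impulse_response L j v) (int n))"
  unfolding impulse_response_def by (simp add: solution_step)

lemma impulse_response_phase_space:
  assumes "\<gamma> > 0" "\<And>n. L n \<in> bounded_operators \<gamma>"
  shows "prehistory (impulse_response L j v) (int n) \<in> phase_space \<gamma>"
proof (cases "j < n")
  case True
  then show ?thesis
    unfolding impulse_response_def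
    by (intro homogeneous_phase_space assms single_phase_space) auto
next
  case False
  then have "prehistory (impulse_response L j v) (int n) = (\<lambda>_. 0)"
    by (auto simp: prehistory_def impulse_response_early)
  then show ?thesis by (simp add: phase_space_zero)
qed

text \<open>Needed for the uniform boundedness argument. The bound obtained here still depends on
  \<open>j\<close> and \<open>n\<close>.\<close>

lemma bounded_linear_impulse_response:
  assumes "\<gamma> > 0" and L: "\<And>n. L n \<in> bounded_operators \<gamma>"
  shows "bounded_linear (\<lambda>v. impulse_response L j v (int n))"
proof (cases "j < n")
  case True
  obtain C where C: "\<And>\<phi>. \<phi> \<in> phase_space \<gamma> \<Longrightarrow>
      phase_norm \<gamma> (prehistory (solution L (Suc j) \<phi> (\<lambda>_. 0)) (int n)) \<le> C * phase_norm \<gamma> \<phi>"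
    using homogeneous_bound[of \<gamma> L "Suc j" n] assms True by auto
  have pt: "norm (solution L (Suc j) \<phi> (\<lambda>_. 0) (int n)) \<le> C * phase_norm \<gamma> \<phi>"
    if "\<phi> \<in> phase_space \<gamma>" for \<phi>
    using phase_bound_0[OF homogeneous_phase_space[of \<gamma> L "Suc j" n \<phi>]] C[OF that] assms that True
    by (auto simp: prehistory_def)
  show ?thesis
  proof (rule bounded_linear_intro[where K = "max 0 C"])
    fix v
    have "norm (impulse_response L j v (int n)) \<le> C * phase_norm \<gamma> (single 0 v)"
      unfolding impulse_response_def by (rule pt[OF single_phase_space])
    also have "\<dots> \<le> max 0 C * phase_norm \<gamma> (single 0 v)"
      by (intro mult_right_mono phase_norm_nonneg single_phase_space) auto
    also have "\<dots> \<le> max 0 C * norm v"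
      by (intro mult_left_mono phase_norm_single_le) auto
    finally show "norm (impulse_response L j v (int n)) \<le> norm v * max 0 C" by (simp add: mult.commute)
  qed (simp_all add: impulse_response_def single_add single_scale homogeneous_add[OF assms]
       homogeneous_scale[OF assms] single_phase_space)
next
  case False
  then show ?thesis by (simp add: impulse_response_early)
qed

text \<open>The superposition of the impulse responses solves the same initial value problem, so
  uniqueness identifies the two.\<close>

lemma variation_of_constants:
  assumes "\<gamma> > 0" and L: "\<And>n. L n \<in> bounded_operators \<gamma>"
  shows "solution L 0 (\<lambda>_. 0) f (int n) = (\<Sum>j<n. impulse_response L j (f j) (int n))"
proof -
  \<comment> \<open>\<open>nat i\<close> is zero for \<open>i \<le> 0\<close>, so the sum is empty
    there and the initial history vanishes.\<close>
  define z where "z i = (\<Sum>j<nat i. impulse_response L j (f j) i)" for i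
  \<comment> \<open>At the earlier time \<open>n - k\<close>, the impulses with
    \<open>n - k \<le> j < n\<close> have no effect yet, so one range of summation serves all
    coordinates.\<close>
  have pre: "prehistory z (int n) = (\<lambda>k. \<Sum>j<n. prehistory (impulse_response L j (f j)) (int n) k)" for n
    unfolding z_def prehistory_def
    by (intro ext sum.mono_neutral_left) (auto intro!: impulse_response_early)
  have "is_solution L 0 (\<lambda>_. 0) f z"
    unfolding is_solution_def
  proof safe
    show "prehistory z (int 0) = (\<lambda>_. 0)" unfolding pre by simp
    fix n
    have "z (int n + 1) = (\<Sum>j<Suc n. impulse_response L j (f j) (int n + 1))"
      by (simp add: z_def nat_add_distrib)
    \<comment> \<open>The summand \<open>j = n\<close> has just been emitted and contributes
      \<open>f n\<close> itself.\<close>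
    also have "\<dots> = (\<Sum>j<n. L n (prehistory (impulse_response L j (f j)) (int n))) + f n"
      by (simp add: impulse_response_Suc impulse_response_step)
    also have "\<dots> = L n (prehistory z (int n)) + f n"
      unfolding pre by (simp add: operator_sum[OF L] impulse_response_phase_space[OF assms])
    finally show "z (int n + 1) = L n (prehistory z (int n)) + f n" .
  qed
  then show ?thesis using solution_eqI z_def by fastforce
qed

section \<open>Uniform boundedness for summable forcings\<close>

text \<open>
  Gliding hump after Sokal: scaled impulses \<open>3\<^sup>-\<^sup>k\<close> are added one after the other, each with the sign
  that makes the current hump survive; the later terms can destroy at most three quarters of it.
\<close>
lemma uniform_boundedness_ell_1:
  fixes T :: "nat \<Rightarrow> nat \<Rightarrow> 'a::banach \<Rightarrow> 'b::real_normed_vector"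
  assumes lin: "\<And>n j. bounded_linear (T n j)"
    and bd: "\<And>f. summable (\<lambda>j. norm (f j)) \<Longrightarrow> bounded (range (\<lambda>n. \<Sum>j<n. T n j (f j)))"
  shows "\<exists>K. \<forall>n v. \<forall>j<n. norm (T n j v) \<le> K * norm v"
proof (rule ccontr)
  assume unbounded: "\<not> ?thesis"
  \<comment> \<open>\<open>insert 0\<close> keeps the maximum defined for
    \<open>n = 0\<close>.\<close>
  define N where "N n = Max (insert 0 ((\<lambda>j. onorm (T n j)) ` {..<n}))" for n
  have NT: "norm (T n j v) \<le> N n * norm v" if "j < n" for n j v
  proof -
    have "onorm (T n j) \<le> N n" unfolding N_def using that by (intro Max_ge) auto
    then have "onorm (T n j) * norm v \<le> N n * norm v" by (intro mult_right_mono) auto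
    with onorm[OF lin] show ?thesis by (rule order_trans)
  qed
  have large: "\<exists>n. C < N n" for C
  proof (rule ccontr)
    assume "\<not> ?thesis"
    then have "N n * norm v \<le> C * norm v" for n and v :: 'a
      by (intro mult_right_mono) (auto simp: not_less)
    with NT unbounded show False by (meson order_trans)
  qed
  \<comment> \<open>The threshold is chosen so that one sixth of \<open>N n\<close>, scaled by
    \<open>3 ^ k\<close> downwards, still exceeds \<open>k\<close>. The factor \<open>2 / 3\<close>
    leaves room to find a vector that nearly attains the operator norm.\<close>
  have "\<exists>n j v. j < n \<and> norm v \<le> 1 \<and> 2 / 3 * N n \<le> norm (T n j v) \<and> 6 * 3 ^ k * real k < N n" for k
  proof -
    obtain n where n: "6 * 3 ^ k * real k < N n" using large by blast
    have "0 \<le> 6 * 3 ^ k * real k" by simp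
    with n have pos: "0 < N n" by linarith
    have "N n \<in> insert 0 ((\<lambda>j. onorm (T n j)) ` {..<n})"
      unfolding N_def by (rule Max_in) auto
    with pos obtain j where j: "j < n" "N n = onorm (T n j)" by auto
    have "\<exists>v. 2 / 3 * N n * norm v < norm (T n j v)"
    proof (rule ccontr)
      assume "\<not> ?thesis"
      then have "norm (T n j v) \<le> 2 / 3 * N n * norm v" for v by (simp add: not_less)
      then have "onorm (T n j) \<le> 2 / 3 * N n" using pos by (intro onorm_bound) auto
      with j pos show False by simp
    qed
    then obtain v where v: "2 / 3 * N n * norm v < norm (T n j v)" ..
    have "v \<noteq> 0" using v linear_simps(3)[OF lin] by auto
    define w where "w = (1 / norm v) *\<^sub>R v"
    have "norm w \<le> 1" by (simp add: w_def)
    moreover have "2 / 3 * N n \<le> norm (T n j w)"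
      using v \<open>v \<noteq> 0\<close> by (simp add: w_def linear_simps(5)[OF lin] field_simps)
    ultimately show ?thesis using n j(1) by blast
  qed
  then obtain n j v where nj: "\<And>k. j k < n k" and v: "\<And>k. norm (v k) \<le> 1"
    and Tv: "\<And>k. 2 / 3 * N (n k) \<le> norm (T (n k) (j k) (v k))"
    and Nk: "\<And>k. 6 * 3 ^ k * real k < N (n k)"
    by metis
  define S where "S m g = (\<Sum>i<m. T m i (g i))" for m and g :: "nat \<Rightarrow> 'a"
  define e where "e s k i = (if i = j k then (s * (1 / 3) ^ k) *\<^sub>R v k else 0)" for s k i
  have S_add: "S m (\<lambda>i. g i + h i) = S m g + S m h" for m g h
    unfolding S_def by (simp add: linear_simps(1)[OF lin] sum.distrib)
  have S_e: "S (n k) (e s k) = (s * (1 / 3) ^ k) *\<^sub>R T (n k) (j k) (v k)" for s k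
  proof -
    have "S (n k) (e s k) = (\<Sum>i<n k. if i = j k then (s * (1 / 3) ^ k) *\<^sub>R T (n k) i (v k) else 0)"
      unfolding S_def e_def
      by (intro sum.cong) (auto simp: linear_simps(3)[OF lin] linear_simps(5)[OF lin])
    then show ?thesis using nj by simp
  qed
  \<comment> \<open>The vectors \<open>a + b\<close> and \<open>a - b\<close> differ by
    \<open>2 *\<^sub>R b\<close>, so one of them has norm at least \<open>norm b\<close>.\<close>
  have "\<exists>s. \<bar>s\<bar> = 1 \<and> (1 / 3) ^ k * norm (T (n k) (j k) (v k)) \<le> norm (S (n k) (\<lambda>i. g i + e s k i))" for k g
  proof -
    define a where "a = S (n k) g"
    define b where "b = ((1 / 3) ^ k) *\<^sub>R T (n k) (j k) (v k)"
    have b: "norm b = (1 / 3) ^ k * norm (T (n k) (j k) (v k))" by (simp add: b_def)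
    have S1: "S (n k) (\<lambda>i. g i + e s k i) = a + s *\<^sub>R b" for s
      by (simp add: S_add S_e a_def b_def)
    have "norm (2 *\<^sub>R b) \<le> norm (a + b) + norm (a - b)"
      using norm_triangle_ineq4[of "a + b" "a - b"] by (simp add: scaleR_2)
    then consider "norm b \<le> norm (a + 1 *\<^sub>R b)" | "norm b \<le> norm (a + (- 1) *\<^sub>R b)" by fastforce
    then show ?thesis
    proof cases
      case 1
      then show ?thesis by (intro exI[of _ 1]) (simp only: S1 b, simp)
    next
      case 2
      then show ?thesis by (intro exI[of _ "- 1"]) (simp only: S1 b, simp)
    qed
  qed
  then obtain sg where sg: "\<And>k g. \<bar>sg k g\<bar> = 1"
    "\<And>k g. (1 / 3) ^ k * norm (T (n k) (j k) (v k)) \<le> norm (S (n k) (\<lambda>i. g i + e (sg k g) k i))"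
    by metis
  \<comment> \<open>The sign of hump \<open>k\<close> is chosen in view of the sum
    \<open>F k\<close> of all earlier humps.\<close>
  define F where "F = rec_nat (\<lambda>_. 0) (\<lambda>k g i. g i + e (sg k g) k i)"
  define d where "d k = e (sg k (F k)) k" for k
  have F_Suc: "F (Suc k) = (\<lambda>i. F k i + d k i)" for k by (simp add: F_def d_def)
  have F_sum: "F k i = (\<Sum>l<k. d l i)" for k i
    by (induction k) (simp_all add: F_Suc, simp add: F_def)
  have hump: "(1 / 3) ^ k * norm (T (n k) (j k) (v k)) \<le> norm (S (n k) (F (Suc k)))" for k
    using sg(2) unfolding F_Suc d_def .
  have d_eq: "norm (d k i) = (if i = j k then (1 / 3) ^ k * norm (v k) else 0)" for k i
    by (simp add: d_def e_def abs_mult sg(1))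
  have d_le: "norm (d k i) \<le> (1 / 3) ^ k" for k i
    using v by (auto simp: d_eq mult_left_le)
  have d_sum: "(\<Sum>i<m. norm (d k i)) \<le> (1 / 3) ^ k" for k m
    using v by (auto simp: d_eq mult_left_le)
  have geo: "summable (\<lambda>l. (1 / 3 :: real) ^ (l + k))" for k
    by (intro summable_ignore_initial_segment summable_geometric) simp
  have d_summable: "summable (\<lambda>l. norm (d (l + k) i))" for k i
    using d_le by (intro summable_comparison_test'[OF geo[of k]]) simp
  \<comment> \<open>Different humps may sit on the same coordinate, so \<open>f i\<close> is itself
    a series.\<close>
  define f where "f i = (\<Sum>k. d k i)" for i
  have tail: "(\<Sum>i<m. norm (f i - F k i)) \<le> (1 / 3) ^ k * (3 / 2)" for k m
  proof -
    have "norm (f i - F k i) \<le> (\<Sum>l. norm (d (l + k) i))" for i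
    proof -
      have "summable (\<lambda>k. d k i)" using d_summable[of 0 i] by (simp add: summable_norm_cancel)
      then have "f i - F k i = (\<Sum>l. d (l + k) i)"
        unfolding f_def F_sum by (rule suminf_minus_initial_segment[symmetric])
      then show ?thesis using summable_norm[OF d_summable] by simp
    qed
    then have "(\<Sum>i<m. norm (f i - F k i)) \<le> (\<Sum>i<m. \<Sum>l. norm (d (l + k) i))"
      by (rule sum_mono)
    also have "\<dots> = (\<Sum>l. \<Sum>i<m. norm (d (l + k) i))"
      using d_summable by (rule suminf_sum[symmetric])
    also have "\<dots> \<le> (\<Sum>l. (1 / 3) ^ (l + k))"
      using d_summable by (intro suminf_le d_sum geo summable_sum)
    also have "\<dots> = (1 / 3) ^ k * (3 / 2)"
      by (simp add: power_add suminf_mult2[symmetric] summable_geometric suminf_geometric)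
    finally show ?thesis .
  qed
  \<comment> \<open>The case \<open>k = 0\<close> of \<open>tail\<close>, where \<open>F 0\<close>
    is zero, shows that \<open>f\<close> is summable.\<close>
  have "(\<Sum>i<m. norm (f i)) \<le> 3 / 2" for m
    using tail[of 0 m] by (simp add: F_sum)
  then have "summable (\<lambda>i. norm (f i))" by (intro summableI_nonneg_bounded[of _ "3 / 2"]) simp_all
  then obtain B where B: "\<And>m. norm (S m f) \<le> B"
    using bd unfolding S_def bounded_iff by auto
  have "real k \<le> B" for k
  proof -
    let ?m = "n k"
    have N_pos: "0 \<le> N ?m" using Nk[of k] by (smt (verit) mult_nonneg_nonneg of_nat_0_le_iff zero_le_power)
    have "S ?m (F (Suc k)) = S ?m f - S ?m (\<lambda>i. f i - F (Suc k) i)"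
      using S_add[of ?m "F (Suc k)" "\<lambda>i. f i - F (Suc k) i"] by simp
    then have "norm (S ?m (F (Suc k))) \<le> norm (S ?m f) + norm (S ?m (\<lambda>i. f i - F (Suc k) i))"
      by (simp add: norm_triangle_ineq4)
    also have "norm (S ?m (\<lambda>i. f i - F (Suc k) i)) \<le> (\<Sum>i<?m. N ?m * norm (f i - F (Suc k) i))"
      unfolding S_def by (intro sum_norm_le NT) auto
    also have "\<dots> \<le> N ?m * ((1 / 3) ^ Suc k * (3 / 2))"
      unfolding sum_distrib_left[symmetric] by (intro mult_left_mono tail N_pos)
    finally have "norm (S ?m (F (Suc k))) \<le> B + N ?m * ((1 / 3) ^ k / 2)" using B[of ?m] by simp
    moreover have "(1 / 3) ^ k * (2 / 3 * N ?m) \<le> norm (S ?m (F (Suc k)))"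
      using Tv by (intro order_trans[OF mult_left_mono hump]) auto
    \<comment> \<open>The hump has size at least \<open>2 / 3\<close> and the later terms at most
      \<open>1 / 2\<close>, in units of \<open>(1 / 3) ^ k * N ?m\<close>; their difference is the
      \<open>1 / 6\<close> here.\<close>
    ultimately have "(1 / 3) ^ k * N ?m / 6 \<le> B" by (simp add: field_simps)
    moreover have "real k \<le> (1 / 3) ^ k * N ?m / 6"
      using Nk[of k] by (simp add: field_simps)
    ultimately show ?thesis by linarith
  qed
  then show False using reals_Archimedean2[of B] by (meson not_le)
qed

section \<open>Uniform bounds from stability under summable forcings\<close>

lemma impulse_response_bounded:
  fixes L :: "nat \<Rightarrow> 'a::banach history \<Rightarrow> 'a"
  assumes "\<gamma> > 0" and L: "\<And>n. L n \<in> bounded_operators \<gamma>" and "ell_1_infinity_stable L"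
  obtains K where "K \<ge> 0" "\<And>j n v. norm (impulse_response L j v (int n)) \<le> K * norm v"
proof -
  have "\<exists>K. \<forall>n v. \<forall>j<n. norm (impulse_response L j v (int n)) \<le> K * norm v"
    using assms(3) bounded_linear_impulse_response[OF assms(1) L]
    by (intro uniform_boundedness_ell_1)
      (auto simp: ell_1_infinity_stable_def ell_1_def ell_infinity_def variation_of_constants[OF assms(1) L])
  then obtain K where K: "\<And>n v j. j < n \<Longrightarrow> norm (impulse_response L j v (int n)) \<le> K * norm v"
    by blast
  have "norm (impulse_response L j v (int n)) \<le> \<bar>K\<bar> * norm v" for j n v
  proof (cases "j < n")
    case True
    have "K * norm v \<le> \<bar>K\<bar> * norm v" by (intro mult_right_mono) auto
    with K[OF True] show ?thesis by (rule order_trans)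
  qed (simp add: impulse_response_early)
  then show thesis using that[of "\<bar>K\<bar>"] by simp
qed

text \<open>
  At time \<open>n\<close> the response to the impulse \<open>v\<close> emitted \<open>k + 1\<close> steps earlier has \<open>v\<close> as its
  coordinate \<open>k\<close>, zeros beyond, and uniformly bounded coordinates before, which the induction
  hypothesis handles.
\<close>
lemma operator_single_bounded:
  assumes "\<gamma> > 0" and L: "\<And>n. L n \<in> bounded_operators \<gamma>"
    and K: "K \<ge> 0" "\<And>j n v. norm (impulse_response L j v (int n)) \<le> K * norm v"
  shows "\<exists>a\<ge>0. \<forall>n v. k < n \<longrightarrow> norm (L n (single k v)) \<le> a * norm v"
proof (induction k rule: less_induct)
  case (less k)
  then obtain a where a: "\<And>i. i < k \<Longrightarrow> a i \<ge> 0"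
    "\<And>i n v. i < k \<Longrightarrow> i < n \<Longrightarrow> norm (L n (single i v)) \<le> a i * norm v"
    by metis
  have "norm (L n (single k v)) \<le> (K + (\<Sum>i<k. a i * K)) * norm v" if "k < n" for n v
  proof -
    define y where "y = impulse_response L (n - Suc k) v"
    have y: "norm (y (int n - int i)) \<le> K * norm v" if "i \<le> k" for i
      using K(2)[of "n - Suc k" v "n - i"] that \<open>k < n\<close> by (simp add: y_def)
    have yk: "y (int n - int k) = v"
      using impulse_response_Suc[of L "n - Suc k" v] \<open>k < n\<close>
      by (simp add: y_def algebra_simps)
    have "tail_proj (- int (Suc k)) (prehistory y (int n)) = (\<lambda>_. 0)"
      using \<open>k < n\<close> by (auto simp: fun_eq_iff tail_proj_def prehistory_def y_def intro!: impulse_response_early)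
    then have "prehistory y (int n) = (\<lambda>l. \<Sum>i<Suc k. single i (y (int n - int i)) l)"
      using tail_proj_decomp[of "prehistory y (int n)" "Suc k"] by (simp add: prehistory_def)
    then have "L n (prehistory y (int n)) = (\<Sum>i<Suc k. L n (single i (y (int n - int i))))"
      by (simp only: operator_sum[OF L] single_phase_space)
    moreover have "L n (prehistory y (int n)) = y (int (Suc n))"
      using impulse_response_step[of "n - Suc k" n L v] \<open>k < n\<close> by (simp add: y_def add.commute)
    \<comment> \<open>The term \<open>i = k\<close> is isolated; what remains is the next value of
      the response and the lower coordinates.\<close>
    ultimately have "L n (single k v) = y (int (Suc n)) - (\<Sum>i<k. L n (single i (y (int n - int i))))"
      by (simp add: yk)
    then have "norm (L n (single k v)) \<le> norm (y (int (Suc n))) + norm (\<Sum>i<k. L n (single i (y (int n - int i))))"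
      by (simp add: norm_triangle_ineq4)
    also have "\<dots> \<le> K * norm v + (\<Sum>i<k. a i * (K * norm v))"
    proof (intro add_mono sum_norm_le)
      show "norm (y (int (Suc n))) \<le> K * norm v" unfolding y_def by (rule K(2))
      fix i assume "i \<in> {..<k}"
      then have i: "i < k" by simp
      have "norm (L n (single i (y (int n - int i)))) \<le> a i * norm (y (int n - int i))"
        using i \<open>k < n\<close> by (intro a(2)) auto
      also have "\<dots> \<le> a i * (K * norm v)" using i by (intro mult_left_mono y a(1)) auto
      finally show "norm (L n (single i (y (int n - int i)))) \<le> a i * (K * norm v)" .
    qed
    finally show ?thesis by (simp add: distrib_right sum_distrib_right mult.assoc)
  qed
  moreover have "K + (\<Sum>i<k. a i * K) \<ge> 0" using K(1) a(1) by (intro add_nonneg_nonneg sum_nonneg) auto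
  ultimately show ?case by blast
qed

text \<open>A history splits into \<open>M\<close> recent coordinates and the tail. For
  \<open>n \<ge> M\<close> all recent coordinates fall under \<open>operator_single_bounded\<close>;
  the finitely many earlier \<open>n\<close> use their individual bounds.\<close>

lemma operators_uniformly_bounded:
  assumes "\<gamma> > 0" and L: "\<And>n. L n \<in> bounded_operators \<gamma>"
    and K: "K \<ge> 0" "\<And>j n v. norm (impulse_response L j v (int n)) \<le> K * norm v"
    and m: "m \<le> 0" "bdd_above (range (\<lambda>n. operator_norm \<gamma> (L n \<circ> tail_proj m)))"
  obtains A where "A \<ge> 0" "\<And>n \<phi>. \<phi> \<in> phase_space \<gamma> \<Longrightarrow> norm (L n \<phi>) \<le> A * phase_norm \<gamma> \<phi>"
proof -
  define M where "M = nat (- m)"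
  have mM: "m = - int M" using m(1) by (simp add: M_def)
  obtain B where B: "\<And>n. operator_norm \<gamma> (L n \<circ> tail_proj m) \<le> B"
    using m(2) unfolding bdd_above_def by blast
  obtain a where a: "\<And>k. a k \<ge> 0"
    "\<And>k n v. k < n \<Longrightarrow> norm (L n (single k v)) \<le> a k * norm v"
    using operator_single_bounded[OF assms(1) L K] by metis
  have "\<forall>n. \<exists>C\<ge>0. \<forall>\<phi>\<in>phase_space \<gamma>. norm (L n \<phi>) \<le> C * phase_norm \<gamma> \<phi>"
    by (meson operator_bound[OF L])
  then obtain C where C: "\<And>n. C n \<ge> 0"
    "\<And>n \<phi>. \<phi> \<in> phase_space \<gamma> \<Longrightarrow> norm (L n \<phi>) \<le> C n * phase_norm \<gamma> \<phi>"
    by metis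
  \<comment> \<open>The factor \<open>exp (\<gamma> * real k)\<close> undoes the weight of
    coordinate \<open>k\<close> in the phase norm.\<close>
  define D where "D = (\<Sum>k<M. a k * exp (\<gamma> * real k)) + B"
  define A where "A = \<bar>D\<bar> + (\<Sum>n<M. C n)"
  have "norm (L n \<phi>) \<le> A * phase_norm \<gamma> \<phi>" if \<phi>: "\<phi> \<in> phase_space \<gamma>" for n \<phi>
  proof (cases "n < M")
    case True
    then have "C n \<le> (\<Sum>n<M. C n)" using C(1) by (intro member_le_sum) auto
    then have "C n * phase_norm \<gamma> \<phi> \<le> A * phase_norm \<gamma> \<phi>"
      using phase_norm_nonneg[OF \<phi>] by (intro mult_right_mono) (auto simp: A_def)
    with C(2)[OF \<phi>] show ?thesis by (rule order_trans)
  next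
    case False
    have "L n \<phi> = L n (\<lambda>k. (\<Sum>i<M. single i (\<phi> i) k) + tail_proj m \<phi> k)"
      using tail_proj_decomp[of \<phi> M] mM by simp
    also have "\<dots> = (\<Sum>i<M. L n (single i (\<phi> i))) + L n (tail_proj m \<phi>)"
      by (simp add: operator_add[OF L] operator_sum[OF L] phase_space_sum single_phase_space
          tail_proj_phase_space \<phi>)
    finally have "norm (L n \<phi>) \<le> norm (\<Sum>i<M. L n (single i (\<phi> i))) + norm (L n (tail_proj m \<phi>))"
      by (simp add: norm_triangle_ineq)
    also have "\<dots> \<le> (\<Sum>i<M. a i * (exp (\<gamma> * real i) * phase_norm \<gamma> \<phi>)) + B * phase_norm \<gamma> \<phi>"
    proof (intro add_mono sum_norm_le operator_norm_bound[OF L] B \<phi>)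
      fix i assume "i \<in> {..<M}"
      then have "norm (L n (single i (\<phi> i))) \<le> a i * norm (\<phi> i)"
        using False by (intro a(2)) auto
      also have "norm (\<phi> i) \<le> exp (\<gamma> * real i) * phase_norm \<gamma> \<phi>"
        using phase_bound[OF \<phi>, of i] by (simp add: exp_minus field_simps)
      finally show "norm (L n (single i (\<phi> i))) \<le> a i * (exp (\<gamma> * real i) * phase_norm \<gamma> \<phi>)"
        using a(1) by (simp add: mult_left_mono)
    qed
    also have "\<dots> = D * phase_norm \<gamma> \<phi>"
      by (simp add: D_def distrib_right sum_distrib_right mult.assoc)
    also have "\<dots> \<le> A * phase_norm \<gamma> \<phi>"
      using phase_norm_nonneg[OF \<phi>] sum_nonneg[of "{..<M}" C] C(1)
      by (intro mult_right_mono) (auto simp: A_def)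
    finally show ?thesis .
  qed
  moreover have "A \<ge> 0" using C(1) by (simp add: A_def sum_nonneg)
  ultimately show thesis using that by blast
qed

section \<open>From uniform bounds to uniform stability\<close>

lemma uniformly_stable_X_of_impulse_response:
  assumes \<gamma>: "\<gamma> > 0" and L: "\<And>n. L n \<in> bounded_operators \<gamma>"
    and K: "K \<ge> 0" "\<And>j n v. norm (impulse_response L j v (int n)) \<le> K * norm v"
    and A: "A \<ge> 0" "\<And>n \<phi>. \<phi> \<in> phase_space \<gamma> \<Longrightarrow> norm (L n \<phi>) \<le> A * phase_norm \<gamma> \<phi>"
  shows "uniformly_stable_X \<gamma> L"
proof -
  define q where "q = exp (- \<gamma>)"
  have q: "0 < q" "q < 1" using \<gamma> by (auto simp: q_def)
  have bound: "norm (solution L \<tau> \<phi> (\<lambda>_. 0) (int n)) \<le> (1 + K * A / (1 - q)) * phase_norm \<gamma> \<phi>"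
    if "\<tau> \<le> n" and \<phi>: "\<phi> \<in> phase_space \<gamma>" for \<tau> n \<phi>
  proof -
    define x where "x = solution L \<tau> \<phi> (\<lambda>_. 0)"
    \<comment> \<open>After time \<open>\<tau>\<close>, the prehistory of \<open>x\<close> splits
      into that of the cut-off solution \<open>z\<close> and the part \<open>d\<close> inherited
      from \<open>\<phi>\<close>. Applying \<open>L\<close> to \<open>d\<close> yields the forcing
      \<open>f\<close> that makes up for the cut.\<close>
    define z where "z i = (if i \<le> int \<tau> then 0 else x i)" for i
    define d where "d i k = (if i - int k \<le> int \<tau> then x (i - int k) else 0)" for i k
    define f where "f i = (if i < \<tau> then 0 else L i (d (int i)))" for i
    have d: "norm (d (int i) k) * exp (\<gamma> * (- real k)) \<le> q ^ (i - \<tau>) * phase_norm \<gamma> \<phi>"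
      if "\<tau> \<le> i" for i k
    proof (cases "int i - int k \<le> int \<tau>")
      case True
      \<comment> \<open>Coordinate \<open>k\<close> at time \<open>i\<close> is coordinate
        \<open>l\<close> of \<open>\<phi>\<close>, pushed back by \<open>i - \<tau>\<close> places;
        the change of weight is the factor \<open>q ^ (i - \<tau>)\<close>.\<close>
      define l where "l = k - (i - \<tau>)"
      have l: "k = l + (i - \<tau>)" using True that by (auto simp: l_def)
      have "nat (int \<tau> - (int i - int k)) = l" using l that by simp
      then have "d (int i) k = \<phi> l"
        using True solution_initial[OF True, of L \<phi> "\<lambda>_. 0"] by (simp add: d_def x_def)
      moreover have "exp (\<gamma> * (- real k)) = q ^ (i - \<tau>) * exp (\<gamma> * (- real l))"
        by (simp add: l q_def exp_of_nat_mult[symmetric] exp_add[symmetric] algebra_simps)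
      ultimately show ?thesis
        using mult_left_mono[OF phase_bound[OF \<phi>, of l], of "q ^ (i - \<tau>)"] q
        by (simp add: mult_ac)
    next
      case False
      then show ?thesis using phase_norm_nonneg[OF \<phi>] q by (simp add: d_def)
    qed
    have "is_solution L 0 (\<lambda>_. 0) f z"
      unfolding is_solution_def
    proof safe
      show "prehistory z (int 0) = (\<lambda>_. 0)" by (auto simp: prehistory_def z_def)
      fix i
      show "z (int i + 1) = L i (prehistory z (int i)) + f i"
      proof (cases "i < \<tau>")
        case True
        then have "prehistory z (int i) = (\<lambda>_. 0)" by (auto simp: prehistory_def z_def)
        with True show ?thesis by (simp add: z_def f_def operator_zero[OF L])
      next
        case False
        have x_phase: "prehistory x (int i) \<in> phase_space \<gamma>"
          unfolding x_def using False by (intro homogeneous_phase_space[OF \<gamma> L] \<phi>) auto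
        have split: "prehistory x (int i) = (\<lambda>k. prehistory z (int i) k + d (int i) k)"
          by (auto simp: prehistory_def z_def d_def)
        have "prehistory z (int i) \<in> phase_space \<gamma>" "d (int i) \<in> phase_space \<gamma>"
          by (rule phase_space_mono[OF x_phase]; simp add: prehistory_def z_def d_def)+
        then have "L i (prehistory x (int i)) = L i (prehistory z (int i)) + f i"
          unfolding split using False by (simp add: operator_add[OF L] f_def)
        then show ?thesis
          using False solution_step[of \<tau> i L \<phi> "\<lambda>_. 0"] by (simp add: x_def z_def)
      qed
    qed
    from solution_eqI[OF this] have z: "z (int n) = (\<Sum>j<n. impulse_response L j (f j) (int n))"
      using variation_of_constants[of \<gamma> L f n, OF \<gamma> L] by simp
    have f_le: "norm (f i) \<le> A * (q ^ (i - \<tau>) * phase_norm \<gamma> \<phi>)" if "\<tau> \<le> i" for i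
    proof -
      have "norm (f i) \<le> A * phase_norm \<gamma> (d (int i))"
        using that A(2)[OF phase_spaceI[OF d[OF that]]] by (simp add: f_def)
      also have "\<dots> \<le> A * (q ^ (i - \<tau>) * phase_norm \<gamma> \<phi>)"
        by (intro mult_left_mono A(1) phase_norm_le d that)
      finally show ?thesis .
    qed
    have "norm (z (int n)) \<le> (\<Sum>j<n. K * norm (f j))"
      unfolding z by (intro sum_norm_le K(2))
    also have "\<dots> = (\<Sum>j\<in>{\<tau>..<n}. K * norm (f j))"
      by (intro sum.mono_neutral_right) (auto simp: f_def)
    also have "\<dots> \<le> (\<Sum>j\<in>{\<tau>..<n}. K * (A * (q ^ (j - \<tau>) * phase_norm \<gamma> \<phi>)))"
      by (intro sum_mono mult_left_mono f_le K(1)) auto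
    also have "\<dots> = K * A * phase_norm \<gamma> \<phi> * (\<Sum>j\<in>{\<tau>..<n}. q ^ (j - \<tau>))"
      by (simp add: sum_distrib_left mult_ac)
    also have "(\<Sum>j\<in>{\<tau>..<n}. q ^ (j - \<tau>)) = (\<Sum>l<n - \<tau>. q ^ l)"
      by (rule sum.reindex_bij_witness[of _ "\<lambda>l. l + \<tau>" "\<lambda>j. j - \<tau>"]) auto
    also have "\<dots> \<le> 1 / (1 - q)"
      using sum_le_suminf[OF summable_geometric, of q "{..<n - \<tau>}"] suminf_geometric[of q] q by simp
    finally have z_le: "norm (z (int n)) \<le> K * A * phase_norm \<gamma> \<phi> * (1 / (1 - q))"
      using K(1) A(1) phase_norm_nonneg[OF \<phi>] by (simp add: mult_left_mono)
    \<comment> \<open>The two functions agree after \<open>\<tau>\<close>. At \<open>\<tau>\<close>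
      itself \<open>z\<close> is zero while \<open>x\<close> equals \<open>\<phi> 0\<close>, which
      explains the summand 1 in the constant.\<close>
    have "norm (x (int n)) \<le> norm (z (int n)) + phase_norm \<gamma> \<phi>"
    proof (cases "n = \<tau>")
      case True
      then show ?thesis
        using phase_bound_0[OF \<phi>] solution_initial[of "int \<tau>" \<tau> L \<phi> "\<lambda>_. 0"] by (simp add: x_def z_def)
    next
      case False
      then show ?thesis using \<open>\<tau> \<le> n\<close> phase_norm_nonneg[OF \<phi>] by (simp add: z_def)
    qed
    with z_le show ?thesis by (simp add: x_def distrib_right distrib_left mult_ac)
  qed
  moreover have "1 + K * A / (1 - q) \<ge> 1" using K(1) A(1) q by simp
  ultimately show ?thesis unfolding uniformly_stable_X_def by blast
qed

text \<open>The current value is coordinate 0 of the prehistory. Conversely, each coordinate of the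
  prehistory is either a value of the solution from \<open>\<tau>\<close> on or a coordinate of
  \<open>\<phi>\<close> pushed back, and since \<open>\<gamma> > 0\<close> the weights do not
  enlarge either.\<close>

lemma uniformly_stable_B_iff_X:
  assumes \<gamma>: "\<gamma> > 0" and L: "\<And>n. L n \<in> bounded_operators \<gamma>"
  shows "uniformly_stable_B \<gamma> L \<longleftrightarrow> uniformly_stable_X \<gamma> L"
proof
  assume "uniformly_stable_B \<gamma> L"
  then obtain K where K: "K \<ge> 1" "\<And>\<tau> n \<phi>. \<tau> \<le> n \<Longrightarrow> \<phi> \<in> phase_space \<gamma> \<Longrightarrow>
      phase_norm \<gamma> (prehistory (solution L \<tau> \<phi> (\<lambda>_. 0)) (int n)) \<le> K * phase_norm \<gamma> \<phi>"
    unfolding uniformly_stable_B_def by blast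
  have "norm (solution L \<tau> \<phi> (\<lambda>_. 0) (int n)) \<le> K * phase_norm \<gamma> \<phi>"
    if "\<tau> \<le> n" "\<phi> \<in> phase_space \<gamma>" for \<tau> n \<phi>
    using phase_bound_0[OF homogeneous_phase_space[of \<gamma> L, OF \<gamma> L that]] K(2)[OF that]
    by (simp add: prehistory_def)
  with K(1) show "uniformly_stable_X \<gamma> L" unfolding uniformly_stable_X_def by blast
next
  assume "uniformly_stable_X \<gamma> L"
  then obtain K where K: "K \<ge> 1" "\<And>\<tau> n \<phi>. \<tau> \<le> n \<Longrightarrow> \<phi> \<in> phase_space \<gamma> \<Longrightarrow>
      norm (solution L \<tau> \<phi> (\<lambda>_. 0) (int n)) \<le> K * phase_norm \<gamma> \<phi>"
    unfolding uniformly_stable_X_def by blast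
  have "norm (prehistory (solution L \<tau> \<phi> (\<lambda>_. 0)) (int n) k) * exp (\<gamma> * (- real k)) \<le> K * phase_norm \<gamma> \<phi>"
    if "\<tau> \<le> n" and \<phi>: "\<phi> \<in> phase_space \<gamma>" for \<tau> n \<phi> k
  proof (cases "\<tau> + k \<le> n")
    case True
    have "norm (solution L \<tau> \<phi> (\<lambda>_. 0) (int (n - k))) * exp (\<gamma> * (- real k)) \<le> (K * phase_norm \<gamma> \<phi>) * 1"
      using True \<gamma> K(1) phase_norm_nonneg[OF \<phi>] by (intro mult_mono K(2) \<phi>) auto
    then show ?thesis using True by (simp add: prehistory_def)
  next
    case False
    define l where "l = k - (n - \<tau>)"
    have l: "k = l + (n - \<tau>)" using False that by (auto simp: l_def)
    have "int n - int k \<le> int \<tau>" "nat (int \<tau> - (int n - int k)) = l" using l that(1) by auto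
    then have "prehistory (solution L \<tau> \<phi> (\<lambda>_. 0)) (int n) k = \<phi> l"
      by (simp add: prehistory_def solution_initial)
    moreover have "norm (\<phi> l) * exp (\<gamma> * (- real k)) \<le> norm (\<phi> l) * exp (\<gamma> * (- real l))"
      using \<gamma> l by (intro mult_left_mono) (auto simp: algebra_simps)
    moreover have "phase_norm \<gamma> \<phi> \<le> K * phase_norm \<gamma> \<phi>"
      using K(1) mult_right_mono[OF K(1) phase_norm_nonneg[OF \<phi>]] by simp
    ultimately show ?thesis using phase_bound[OF \<phi>, of l] by simp
  qed
  then have "phase_norm \<gamma> (prehistory (solution L \<tau> \<phi> (\<lambda>_. 0)) (int n)) \<le> K * phase_norm \<gamma> \<phi>"
    if "\<tau> \<le> n" "\<phi> \<in> phase_space \<gamma>" for \<tau> n \<phi>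
    using that by (intro phase_norm_le)
  with K(1) show "uniformly_stable_B \<gamma> L" unfolding uniformly_stable_B_def by blast
qed

section \<open>Consequences of uniform stability\<close>

text \<open>\<open>K\<close> does not depend on the starting time, so it bounds the responses to
  impulses emitted at any \<open>j\<close>, and their sum is at most \<open>K\<close> times the norm
  of the forcing.\<close>

lemma ell_1_infinity_stable_of_X:
  assumes \<gamma>: "\<gamma> > 0" and L: "\<And>n. L n \<in> bounded_operators \<gamma>" and "uniformly_stable_X \<gamma> L"
  shows "ell_1_infinity_stable L"
proof -
  obtain K where K: "K \<ge> 1" "\<And>\<tau> n \<phi>. \<tau> \<le> n \<Longrightarrow> \<phi> \<in> phase_space \<gamma> \<Longrightarrow>
      norm (solution L \<tau> \<phi> (\<lambda>_. 0) (int n)) \<le> K * phase_norm \<gamma> \<phi>"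
    using assms(3) unfolding uniformly_stable_X_def by blast
  have impulse: "norm (impulse_response L j v (int n)) \<le> K * norm v" if "j < n" for j n v
  proof -
    have "norm (impulse_response L j v (int n)) \<le> K * phase_norm \<gamma> (single 0 v)"
      unfolding impulse_response_def using that by (intro K(2) single_phase_space) auto
    also have "\<dots> \<le> K * norm v" using K(1) by (intro mult_left_mono phase_norm_single_le) auto
    finally show ?thesis .
  qed
  have "norm (solution L 0 (\<lambda>_. 0) f (int n)) \<le> K * (\<Sum>j. norm (f j))"
    if "summable (\<lambda>n. norm (f n))" for f n
  proof -
    have "norm (solution L 0 (\<lambda>_. 0) f (int n)) \<le> (\<Sum>j<n. K * norm (f j))"
      unfolding variation_of_constants[OF \<gamma> L] by (intro sum_norm_le impulse) auto
    also have "\<dots> \<le> K * (\<Sum>j. norm (f j))"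
      unfolding sum_distrib_left[symmetric] using K(1)
      by (intro mult_left_mono sum_le_suminf that) auto
    finally show ?thesis .
  qed
  then show ?thesis
    unfolding ell_1_infinity_stable_def ell_1_def ell_infinity_def bounded_iff by blast
qed

text \<open>\<open>tail_proj 0\<close> is the identity, and the solution started at \<open>n\<close>
  with history \<open>\<phi>\<close> has the value \<open>L n \<phi>\<close> one step later.\<close>

lemma operator_norm_bounded_of_X:
  assumes "uniformly_stable_X \<gamma> L"
  shows "bdd_above (range (\<lambda>n. operator_norm \<gamma> (L n \<circ> tail_proj 0)))"
proof -
  obtain K where K: "K \<ge> 1" "\<And>\<tau> n \<phi>. \<tau> \<le> n \<Longrightarrow> \<phi> \<in> phase_space \<gamma> \<Longrightarrow>
      norm (solution L \<tau> \<phi> (\<lambda>_. 0) (int n)) \<le> K * phase_norm \<gamma> \<phi>"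
    using assms unfolding uniformly_stable_X_def by blast
  have "norm (L n \<phi>) \<le> K" if \<phi>: "\<phi> \<in> phase_space \<gamma>" "phase_norm \<gamma> \<phi> \<le> 1" for n \<phi>
  proof -
    have "norm (L n \<phi>) \<le> K * phase_norm \<gamma> \<phi>"
      using K(2)[OF le_SucI[OF order_refl] \<phi>(1), of n] solution_step[of n n L \<phi> "\<lambda>_. 0"]
      by (simp add: solution_prehistory add.commute)
    also have "\<dots> \<le> K" using K(1) \<phi>(2) by (intro mult_left_le) auto
    finally show ?thesis .
  qed
  \<comment> \<open>The zero history shows that the unit ball is nonempty, as the least upper bound
    rule demands.\<close>
  then have "operator_norm \<gamma> (L n \<circ> tail_proj 0) \<le> K" for n
    unfolding operator_norm_def
    using phase_space_zero[of \<gamma>] phase_norm_le[of "\<lambda>_. 0" \<gamma> 1]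
    by (intro cSUP_least) (auto simp: tail_proj_def)
  then show ?thesis by (intro bdd_aboveI[of _ K]) auto
qed

theorem theorem4p5:
  fixes \<gamma> :: real and L :: "nat \<Rightarrow> ('a::banach) history \<Rightarrow> 'a"
  assumes "\<gamma> > 0" and "\<And>n. L n \<in> bounded_operators \<gamma>"
  shows "(uniformly_stable_B \<gamma> L \<longleftrightarrow> uniformly_stable_X \<gamma> L) \<and>
         (uniformly_stable_B \<gamma> L \<longleftrightarrow>
           ell_1_infinity_stable L \<and>
           (\<exists>m::int. m \<le> 0 \<and> bdd_above (range (\<lambda>n. operator_norm \<gamma> (L n \<circ> tail_proj m)))))"
proof -
  have "uniformly_stable_X \<gamma> L"
    if stable: "ell_1_infinity_stable L"
      and m: "m \<le> 0" "bdd_above (range (\<lambda>n. operator_norm \<gamma> (L n \<circ> tail_proj m)))" for m :: int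
  proof -
    obtain K where K: "K \<ge> 0" "\<And>j n v. norm (impulse_response L j v (int n)) \<le> K * norm v"
      using impulse_response_bounded[OF assms stable] by blast
    obtain A where "A \<ge> 0" "\<And>n \<phi>. \<phi> \<in> phase_space \<gamma> \<Longrightarrow> norm (L n \<phi>) \<le> A * phase_norm \<gamma> \<phi>"
      using operators_uniformly_bounded[OF assms K m] by blast
    then show ?thesis using uniformly_stable_X_of_impulse_response[OF assms K] by blast
  qed
  \<comment> \<open>Uniform stability provides the tail condition with the witness
    \<open>m = 0\<close>.\<close>
  then have "uniformly_stable_X \<gamma> L \<longleftrightarrow> ell_1_infinity_stable L \<and>
      (\<exists>m::int. m \<le> 0 \<and> bdd_above (range (\<lambda>n. operator_norm \<gamma> (L n \<circ> tail_proj m))))"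
    using ell_1_infinity_stable_of_X[of \<gamma> L, OF assms] operator_norm_bounded_of_X[of \<gamma> L] order_refl
    by metis
  then show ?thesis by (simp only: uniformly_stable_B_iff_X[of \<gamma> L, OF assms] simp_thms)
qed

end
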